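(* Consider the two-queue, single-server system with one-slot switchover time and uncorrelated channels with ON probabilities $p_1,p_2\in(0,1)$, and stationary arrivals with average rates $\lambda_1,\lambda_2$. A necessary condition for stability is $$\rho=\frac{\lambda_1}{p_1}+\frac{\lambda_2}{p_2}<1 .$$ That is, if some control policy makes the system strongly stable, then $\rho<1$.
   Context: Model. Time is slotted, $t\in\{0,1,2,\dots\}$. There are two parallel queues and one server. At slot $t$ the server is at queue $m(t)\in\{1,2\}$. At the beginning of slot $t$ the server observes the queue lengths $\mathbf Q(t)=(Q_1(t),Q_2(t))$ and the channel states $\mathbf C(t)=(C_1(t),C_2(t))\in\{0,1\}^2$ ($1$ = ON/connected, $0$ = OFF/disconnected). It then chooses an action $a_t\in\{0,1\}$: $a_t=1$ means stay at the current queue ($m(t+1)=m(t)$), and $a_t=0$ means switch to the other queue ($m(t+1)\neq m(t)$). Switching takes the whole slot. A control policy chooses $a_t$, possibly at random, from the information observed up to slot $t$ (it has no knowledge of future arrivals or channel states). Dynamics. One packet departs from queue $i$ in slot $t$ if $m(t)=i$, $a_t=1$, $C_i(t)=1$ and $Q_i(t)>0$. Let $D_i(t)\in\{0,1\}$ indicate a departure. Then $Q_i(t+1)=Q_i(t)+A_i(t)-D_i(t)$, where $A_i(t)$ is the number of packets arriving to queue $i$ in slot $t$. Arrivals. For $i\in\{1,2\}$, $A_i(t)$ is a stationary stochastic process with average arrival rate $\lambda_i$ and $\mathbb E[A_i^2(t)]\le A_{\max}^2<\infty$. The processes $A_1(t),A_2(t),C_1(t),C_2(t)$ are independent. Uncorrelated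 channels. $C_i(t)$ is ON with probability $p_i$ and OFF with probability $1-p_i$ in each slot, independently of earlier slots and of the other queue. Strong stability. A queue with length process $Q(t)$ is strongly stable if $\limsup_{t\to\infty}\frac1t\sum_{\tau=0}^{t-1}\mathbb E[Q(\tau)]<\infty$. The system is strongly stable (stable) if both queues are strongly stable. *)

theory Defs
  imports "HOL-Probability.Probability"
begin

datatype queue = Queue1 | Queue2

instance queue :: finite
proof
  have "(UNIV :: queue set) = {Queue1, Queue2}"
    using queue.exhaust by blast
  then show "finite (UNIV :: queue set)"
    by (metis finite.emptyI finite_insert)
qed

fun other :: "queue \<Rightarrow> queue" where
  "other Queue1 = Queue2"
| "other Queue2 = Queue1"

(* What the server sees at the beginning of a slot: its own position, the two queue lengths
   and the two channel states (True = ON). Past actions can be read off the past positions. *)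
type_synonym observation = "queue \<times> (queue \<Rightarrow> nat) \<times> (queue \<Rightarrow> bool)"

(* A possibly randomized policy. The first argument is the outcome of the server's private
   randomization, drawn once for the whole time horizon (fresh coin flips in every slot are the
   case of a sequence-valued seed); the second is the list of observations made in the
   slots 0, ..., t. True means stay, False means switch. *)
type_synonym 'u policy = "'u \<Rightarrow> observation list \<Rightarrow> bool"

(* The sigma-algebra generated by a discrete-valued process. *)
definition process_events :: "'w measure \<Rightarrow> (nat \<Rightarrow> 'w \<Rightarrow> 'b) \<Rightarrow> 'w set set" where
  "process_events M X =
     sets (vimage_algebra (space M) (\<lambda>\<omega> t. X t \<omega>) (\<Pi>\<^sub>M t\<in>UNIV. count_space UNIV))"

definition stationary :: "'w measure \<Rightarrow> (nat \<Rightarrow> 'w \<Rightarrow> 'b) \<Rightarrow> bool" where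
  "stationary M X \<longleftrightarrow>
     (\<forall>k. distr M (\<Pi>\<^sub>M t\<in>UNIV. count_space UNIV) (\<lambda>\<omega> t. X (t + k) \<omega>) =
          distr M (\<Pi>\<^sub>M t\<in>UNIV. count_space UNIV) (\<lambda>\<omega> t. X t \<omega>))"

(* Expectations are taken in [0, infinity], so strong stability entails their finiteness. *)
definition strongly_stable :: "'w measure \<Rightarrow> (nat \<Rightarrow> 'w \<Rightarrow> nat) \<Rightarrow> bool" where
  "strongly_stable M q \<longleftrightarrow>
     limsup (\<lambda>t. (\<Sum>\<tau><t. \<integral>\<^sup>+\<omega>. of_nat (q \<tau> \<omega>) \<partial>M) / of_nat t) < (\<infinity> :: ennreal)"

datatype source = Arrivals queue | Channel queue | Internal

(* m is the server position, act the action, D the departures, Q the queue lengths.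
   The initial position and queue lengths are arbitrary. Together with the seed they form the
   source Internal; its independence of the arrivals and channels is what prevents the policy
   from knowing future arrivals or channel states. *)
locale two_queue_system = prob_space M
  for M :: "'w measure" +
  fixes p lam :: "queue \<Rightarrow> real"
    and Amax :: real
    and A :: "queue \<Rightarrow> nat \<Rightarrow> 'w \<Rightarrow> nat"
    and C :: "queue \<Rightarrow> nat \<Rightarrow> 'w \<Rightarrow> bool"
    and R :: "'u measure"
    and seed :: "'w \<Rightarrow> 'u"
    and pol :: "'u policy"
    and m :: "nat \<Rightarrow> 'w \<Rightarrow> queue"
    and act :: "nat \<Rightarrow> 'w \<Rightarrow> bool"
    and D Q :: "queue \<Rightarrow> nat \<Rightarrow> 'w \<Rightarrow> nat"
  assumes measurable_A: "\<And>i t. A i t \<in> measurable M (count_space UNIV)"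
    and stationary_A: "\<And>i. stationary M (A i)"
    and rate_A: "\<And>i t. expectation (\<lambda>\<omega>. real (A i t \<omega>)) = lam i"
    and second_moment_A:
      "\<And>i t. (\<integral>\<^sup>+\<omega>. ennreal ((real (A i t \<omega>))\<^sup>2) \<partial>M) \<le> ennreal (Amax\<^sup>2)"
    and indep_C: "\<And>i. indep_vars (\<lambda>_. count_space UNIV) (C i) UNIV"
    and prob_C: "\<And>i t. prob {\<omega> \<in> space M. C i t \<omega>} = p i"
    and measurable_seed: "seed \<in> measurable M R"
    and measurable_pol: "\<And>h. (\<lambda>u. pol u h) \<in> measurable R (count_space UNIV)"
    and measurable_m0: "m 0 \<in> measurable M (count_space UNIV)"
    and measurable_Q0: "\<And>i. Q i 0 \<in> measurable M (count_space UNIV)"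
    and indep_sources:
      "indep_sets
         (\<lambda>s. case s of
             Arrivals i \<Rightarrow> process_events M (A i)
           | Channel i \<Rightarrow> process_events M (C i)
           | Internal \<Rightarrow>
               sets (vimage_algebra (space M) (\<lambda>\<omega>. (seed \<omega>, m 0 \<omega>, \<lambda>i. Q i 0 \<omega>))
                 (R \<Otimes>\<^sub>M count_space UNIV \<Otimes>\<^sub>M count_space UNIV)))
         UNIV"
    and act_eq:
      "\<And>t \<omega>. \<omega> \<in> space M \<Longrightarrow>
         act t \<omega> =
           pol (seed \<omega>) (map (\<lambda>s. (m s \<omega>, (\<lambda>i. Q i s \<omega>), (\<lambda>i. C i s \<omega>))) [0..<Suc t])"
    and m_Suc:
      "\<And>t \<omega>. \<omega> \<in> space M \<Longrightarrow> m (Suc t) \<omega> = (if act t \<omega> then m t \<omega> else other (m t \<omega>))"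
    and D_eq:
      "\<And>i t \<omega>. \<omega> \<in> space M \<Longrightarrow>
         D i t \<omega> = of_bool (m t \<omega> = i \<and> act t \<omega> \<and> C i t \<omega> \<and> Q i t \<omega> > 0)"
    and Q_Suc:
      "\<And>i t \<omega>. \<omega> \<in> space M \<Longrightarrow> Q i (Suc t) \<omega> = Q i t \<omega> + A i t \<omega> - D i t \<omega>"

end

theory Submission
  imports Defs
begin

text \<open>Suppose \<open>\<rho> \<ge> 1\<close>. Measure the backlog in slots of service: a packet in queue \<open>i\<close> costs
  \<open>1 / p i\<close> slots on average, so \<open>W t = Q\<^sub>1 t / p\<^sub>1 + Q\<^sub>2 t / p\<^sub>2\<close> is the natural potential. In one slot
  the arrivals raise \<open>W\<close> by \<open>\<rho>\<close> on average, and whatever the server does it lowers \<open>W\<close> by at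
  most \<open>C\<^sub>i t / p\<^sub>i\<close>, where \<open>i\<close> is its position. The position is fixed before the channels
  of the slot are drawn, so this amount has mean one. For \<open>\<rho> > 1\<close> instability follows from the positive
  drift; the substance is the critical case \<open>\<rho> = 1\<close>, where the fluctuations have to do the work. One
  argument covers both cases.

  Write \<open>noise t = 1 - C\<^sub>i t / p\<^sub>i\<close> for the served channel, \<open>walk\<close> for its partial sums and
  \<open>load\<close> for the centred partial sums of the arriving work. Then \<open>W t \<ge> load t + walk t + (\<rho> - 1) t\<close> on every
  path (\<open>backlog_ge\<close>), so the expected backlog is at least the expected positive part of
  \<open>load t + walk t\<close>, which is half of \<open>E \<bar>load t + walk t\<bar>\<close> because the sum has mean zero.

  The processes \<open>load\<close> and \<open>walk\<close> are dependent, since the policy reacts to arrivals, and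
  arrivals need not be ergodic, so no law of large numbers or fluctuation bound is available for
  \<open>load\<close>. But the noise has mean zero given
  all arrivals, including future ones (\<open>expectation_past_times_noise\<close>). Hence \<open>load\<close> cannot
  cancel \<open>walk\<close>: testing against the sign of \<open>load t\<close> gives
  \<open>E \<bar>load t\<bar> \<le> E \<bar>load t + walk t\<bar>\<close>, and so \<open>E \<bar>walk t\<bar> \<le> 2 E \<bar>load t + walk t\<bar>\<close>
  (\<open>expectation_abs_walk_le\<close>).

  Finally \<open>walk\<close> is a martingale with bounded increments whose variances are bounded below, as
  \<open>p i < 1\<close>. Its second moment is at least of order \<open>t\<close>, its fourth moment at most of order
  \<open>t\<^sup>2\<close>, so its first absolute moment is at least of order \<open>sqrt t\<close>
  (\<open>expectation_abs_walk_ge\<close>). The expected backlog then grows at least like \<open>sqrt t\<close>, and its time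
  averages are unbounded, contrary to strong stability.\<close>

section \<open>Independence and countable-valued processes\<close>

text \<open>Two-stage independence: \<open>F\<close> is one source and \<open>F1\<close>, \<open>F2\<close> are independent parts of it, while
  \<open>H\<close> collects the other sources. The sets \<open>f \<inter> h\<close> form an intersection-stable generator on which the
  product rule can be verified, because \<open>f \<inter> g\<close> is still an event of the single source \<open>F\<close>.\<close>

lemma (in prob_space) indep_set_adjoin:
  assumes FH: "indep_set F H" and F12: "indep_set F1 F2"
    and sub: "F1 \<subseteq> F" "F2 \<subseteq> F"
    and stable: "Int_stable F" "Int_stable F1" "Int_stable F2" "Int_stable H"
    and top: "space M \<in> F1" "space M \<in> H"
  shows "indep_set (sigma_sets (space M) (F1 \<union> H)) (sigma_sets (space M) F2)"
proof -
  define P where "P = {f \<inter> h | f h. f \<in> F1 \<and> h \<in> H}"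
  have ev: "F \<subseteq> events" "H \<subseteq> events"
    using indep_setD_ev1[OF FH] indep_setD_ev2[OF FH] by auto
  have "prob ((f \<inter> h) \<inter> g) = prob (f \<inter> h) * prob g" if "f \<in> F1" "h \<in> H" "g \<in> F2" for f g h
  proof -
    have "f \<inter> g \<in> F" using stable(1) that sub by (auto simp: Int_stable_def)
    then have "prob ((f \<inter> g) \<inter> h) = prob (f \<inter> g) * prob h"
      using indep_setD[OF FH] that by blast
    also have "\<dots> = prob (f \<inter> h) * prob g"
      using indep_setD[OF FH, of f h] indep_setD[OF F12, of f g] that sub by auto
    finally show ?thesis by (simp add: Int_ac)
  qed
  then have "indep_set P F2"
    unfolding indep_sets2_eq P_def using ev sub by (auto intro!: sets.Int)
  moreover have "Int_stable P"
  proof (rule Int_stableI)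
    fix a b assume "a \<in> P" "b \<in> P"
    then obtain f h f' h' where "a = f \<inter> h" "b = f' \<inter> h'" "f \<in> F1" "h \<in> H" "f' \<in> F1" "h' \<in> H"
      by (auto simp: P_def)
    then have "a \<inter> b = (f \<inter> f') \<inter> (h \<inter> h')" "f \<inter> f' \<in> F1" "h \<inter> h' \<in> H"
      using stable by (auto simp: Int_stable_def)
    then show "a \<inter> b \<in> P" unfolding P_def by blast
  qed
  ultimately have indep: "indep_set (sigma_sets (space M) P) (sigma_sets (space M) F2)"
    using stable by (intro indep_set_sigma_sets)
  have "F1 \<union> H \<subseteq> P"
  proof
    fix x assume x: "x \<in> F1 \<union> H"
    then have "x \<subseteq> space M" using ev sub sets.sets_into_space by blast
    then have "x = x \<inter> space M" "x = space M \<inter> x" by auto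
    then show "x \<in> P" using x top unfolding P_def by blast
  qed
  then have "sigma_sets (space M) (F1 \<union> H) \<subseteq> sigma_sets (space M) P"
    by (rule sigma_sets_mono')
  then show ?thesis
    using indep unfolding indep_sets2_eq by blast
qed

lemma process_events_vimage:
  "X t -` S \<inter> space M \<in> process_events M X"
proof -
  let ?P = "\<Pi>\<^sub>M t\<in>UNIV. count_space UNIV"
  have "(\<lambda>x. x t) -` S \<inter> space ?P \<in> sets ?P"
    by (rule measurable_sets[where A="count_space UNIV"]) auto
  from in_vimage_algebra[OF this, of "\<lambda>\<omega> t. X t \<omega>" "space M"]
  show ?thesis
    by (simp add: process_events_def vimage_def space_PiM PiE_def)
qed

lemma Int_stable_sets: "Int_stable (sets N)"
  by (rule Int_stableI) auto

lemma Int_stable_sigma_sets: "G \<subseteq> Pow S \<Longrightarrow> Int_stable (sigma_sets S G)"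
  using Int_stable_sets[of "sigma S G"] by simp

text \<open>Positions, queue lengths and observation histories take countably many values, so measurability passes
  through arbitrary functions of them.\<close>

lemma measurable_countable_app2:
  fixes X :: "'a \<Rightarrow> 'b::countable" and Y :: "'a \<Rightarrow> 'c::countable"
  assumes "X \<in> measurable N (count_space UNIV)" "Y \<in> measurable N (count_space UNIV)"
  shows "(\<lambda>\<omega>. h (X \<omega>) (Y \<omega>)) \<in> measurable N (count_space UNIV)"
  by (rule measurable_compose_countable[OF measurable_compose_countable[OF _ assms(1)] assms(2)]) simp

lemma measurable_countable_fun:
  fixes X :: "'i::finite \<Rightarrow> 'a \<Rightarrow> 'b::countable"
  assumes "\<And>i. X i \<in> measurable N (count_space UNIV)"
  shows "(\<lambda>\<omega> i. X i \<omega>) \<in> measurable N (count_space UNIV)"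
proof (subst measurable_count_space_eq2_countable, simp, safe)
  fix f :: "'i \<Rightarrow> 'b"
  have "(\<lambda>\<omega> i. X i \<omega>) -` {f} \<inter> space N = {\<omega> \<in> space N. \<forall>i\<in>UNIV. X i \<omega> = f i}"
    by auto
  also have "\<dots> \<in> sets N"
    using assms by (intro sets.sets_Collect_finite_All) auto
  finally show "(\<lambda>\<omega> i. X i \<omega>) -` {f} \<inter> space N \<in> sets N" .
qed

lemma measurable_countable_map:
  fixes X :: "'i \<Rightarrow> 'a \<Rightarrow> 'b::countable"
  assumes "\<And>i. i \<in> set xs \<Longrightarrow> X i \<in> measurable N (count_space UNIV)"
  shows "(\<lambda>\<omega>. map (\<lambda>i. X i \<omega>) xs) \<in> measurable N (count_space UNIV)"
  using assms
proof (induction xs)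
  case (Cons x xs)
  then show ?case
    using measurable_countable_app2[of "X x" N "\<lambda>\<omega>. map (\<lambda>i. X i \<omega>) xs" "(#)"] by simp
qed simp

lemma UNIV_queue: "(UNIV :: queue set) = {Queue1, Queue2}"
  using queue.exhaust by blast

section \<open>The past of a slot\<close>

context two_queue_system
begin

definition internal_events :: "'w set set" where
  "internal_events =
     sets (vimage_algebra (space M) (\<lambda>\<omega>. (seed \<omega>, m 0 \<omega>, \<lambda>i. Q i 0 \<omega>))
       (R \<Otimes>\<^sub>M count_space UNIV \<Otimes>\<^sub>M count_space UNIV))"

definition source_events :: "source \<Rightarrow> 'w set set" where
  "source_events s =
     (case s of
        Arrivals i \<Rightarrow> process_events M (A i)
      | Channel i \<Rightarrow> process_events M (C i)
      | Internal \<Rightarrow> internal_events)"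

definition slot_events :: "queue \<Rightarrow> nat \<Rightarrow> 'w set set" where
  "slot_events i t = {C i t -` S \<inter> space M | S. True}"

text \<open>The past of slot \<open>t\<close> contains the whole arrival processes, future arrivals included. This is more
  than the server knows; it makes the sign of the cumulative arriving work at any slot an
  admissible test function against the channel noise of every slot.\<close>

definition past_generators :: "nat \<Rightarrow> 'w set set" where
  "past_generators t =
     (\<Union>i. process_events M (A i)) \<union> internal_events \<union> (\<Union>i. \<Union>s<t. slot_events i s)"

definition past :: "nat \<Rightarrow> 'w measure" where
  "past t = sigma (space M) (past_generators t)"

lemma indep_source_events: "indep_sets source_events UNIV"
  using indep_sources unfolding source_events_def internal_events_def .

lemma source_events_subset: "source_events s \<subseteq> events"
  using indep_source_events by (auto simp: indep_sets_def)

lemma Int_stable_source_events: "Int_stable (source_events s)"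
  by (cases s) (auto simp: source_events_def internal_events_def process_events_def
      intro: Int_stable_sets)

lemma slot_events_subset: "slot_events i t \<subseteq> source_events (Channel i)"
  by (auto simp: slot_events_def source_events_def intro: process_events_vimage)

lemma Int_stable_slot_events: "Int_stable (slot_events i t)"
proof (rule Int_stableI)
  fix a b assume "a \<in> slot_events i t" "b \<in> slot_events i t"
  then obtain S T where "a = C i t -` S \<inter> space M" "b = C i t -` T \<inter> space M"
    by (auto simp: slot_events_def)
  then have "a \<inter> b = C i t -` (S \<inter> T) \<inter> space M" by auto
  then show "a \<inter> b \<in> slot_events i t" unfolding slot_events_def by blast
qed

lemma past_generators_eq:
  "past_generators t =
     (\<Union>i. source_events (Arrivals i)) \<union> source_events Internal \<union> (\<Union>i. \<Union>s<t. slot_events i s)"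
  by (simp add: past_generators_def source_events_def)

lemma past_generators_subset: "past_generators t \<subseteq> events"
  unfolding past_generators_eq
  by (intro Un_least UN_least source_events_subset order_trans[OF slot_events_subset source_events_subset])

lemma past_generators_Pow: "past_generators t \<subseteq> Pow (space M)"
  using past_generators_subset sets.sets_into_space by blast

lemma space_past [simp]: "space (past t) = space M"
  by (simp add: past_def past_generators_Pow space_measure_of)

lemma sets_past: "sets (past t) = sigma_sets (space M) (past_generators t)"
  by (simp add: past_def past_generators_Pow sets_measure_of)

lemma measurable_past_events: "f \<in> measurable (past t) N \<Longrightarrow> f \<in> measurable M N"
  using sets.sigma_sets_subset[OF past_generators_subset]
  by (auto simp: measurable_def sets_past)

lemma measurable_past_mono: "s \<le> t \<Longrightarrow> f \<in> measurable (past s) N \<Longrightarrow> f \<in> measurable (past t) N"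
proof -
  assume "s \<le> t"
  then have "past_generators s \<subseteq> past_generators t"
    unfolding past_generators_def by (intro Un_mono UN_mono) auto
  then have "sets (past s) \<subseteq> sets (past t)"
    unfolding sets_past by (rule sigma_sets_mono')
  then show "f \<in> measurable (past s) N \<Longrightarrow> f \<in> measurable (past t) N"
    by (auto simp: measurable_def)
qed

text \<open>The channel of one queue in slot \<open>t\<close> is independent of that channel's earlier slots, and the
  whole channel process is independent of the other sources. So the present channel state is
  independent of the two kinds of information taken together.\<close>

lemma indep_past_slot: "indep_set (sets (past t)) (sigma_sets (space M) (slot_events i t))"
proof -
  let ?\<sigma> = "sigma_sets (space M)"
  define F where "F = ?\<sigma> (source_events (Channel i))"
  define H where "H = ?\<sigma> (\<Union>s\<in>- {Channel i}. source_events s)"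
  define F1 where "F1 = ?\<sigma> (\<Union>s<t. slot_events i s)"
  define F2 where "F2 = ?\<sigma> (slot_events i t)"
  let ?I = "\<lambda>b. if b then {Channel i} else - {Channel i}"
  have "indep_sets (\<lambda>b. ?\<sigma> (\<Union>s\<in>?I b. source_events s)) (UNIV::bool set)"
    using indep_source_events Int_stable_source_events
    by (intro indep_sets_collect_sigma)
      (auto intro: indep_sets_mono_index[of _ UNIV] simp: disjoint_family_on_def)
  also have "(\<lambda>b. ?\<sigma> (\<Union>s\<in>?I b. source_events s)) = case_bool F H"
    by (auto simp: fun_eq_iff F_def H_def split: bool.split)
  finally have FH: "indep_set F H" by (simp add: indep_set_def)

  have "indep_sets (slot_events i) UNIV"
    using indep_C[of i] unfolding indep_vars_def2 slot_events_def by simp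
  then have "indep_sets (\<lambda>b. ?\<sigma> (\<Union>s\<in>(if b then {..<t} else {t}). slot_events i s)) (UNIV::bool set)"
    using Int_stable_slot_events
    by (intro indep_sets_collect_sigma)
      (auto intro: indep_sets_mono_index[of _ UNIV] simp: disjoint_family_on_def)
  also have "(\<lambda>b. ?\<sigma> (\<Union>s\<in>(if b then {..<t} else {t}). slot_events i s)) = case_bool F1 F2"
    by (auto simp: fun_eq_iff F1_def F2_def split: bool.split)
  finally have F12: "indep_set F1 F2" by (simp add: indep_set_def)

  have pow: "source_events s \<subseteq> Pow (space M)" for s
    using source_events_subset sets.sets_into_space by blast
  have "indep_set (?\<sigma> (F1 \<union> H)) (?\<sigma> F2)"
  proof (rule indep_set_adjoin[OF FH F12])
    show "F1 \<subseteq> F" unfolding F1_def F_def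
      by (rule sigma_sets_mono') (use slot_events_subset in blast)
    show "F2 \<subseteq> F" unfolding F2_def F_def
      by (rule sigma_sets_mono') (use slot_events_subset in blast)
    show "Int_stable F" "Int_stable F1" "Int_stable F2" "Int_stable H"
      unfolding F_def F1_def F2_def H_def
      using pow slot_events_subset[of i] pow[of "Channel i"]
      by (auto intro!: Int_stable_sigma_sets dest!: subsetD)
    show "space M \<in> F1" "space M \<in> H"
      by (auto simp: F1_def H_def intro: sigma_sets_top)
  qed
  moreover have "sets (past t) \<subseteq> ?\<sigma> (F1 \<union> H)"
    unfolding sets_past
  proof (rule sigma_sets_mono, safe)
    have src: "source_events s \<subseteq> ?\<sigma> (F1 \<union> H)" if "s \<noteq> Channel i" for s
      using that by (auto simp: H_def intro!: sigma_sets.Basic)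
    fix x assume "x \<in> past_generators t"
    then consider j where "x \<in> source_events (Arrivals j)" | "x \<in> source_events Internal"
      | j s where "s < t" "x \<in> slot_events j s"
      by (auto simp: past_generators_def source_events_def)
    then show "x \<in> ?\<sigma> (F1 \<union> H)"
    proof cases
      case 3
      show ?thesis
      proof (cases "j = i")
        case True
        with 3 show ?thesis by (auto simp: F1_def intro!: sigma_sets.Basic)
      next
        case False
        with 3 src[of "Channel j"] slot_events_subset[of j s] show ?thesis by auto
      qed
    qed (use src in auto)
  qed
  moreover have "F2 \<subseteq> ?\<sigma> F2" by auto
  ultimately show ?thesis unfolding F2_def[symmetric] indep_sets2_eq by blast
qed

section \<open>The server cannot anticipate the channels\<close>

lemma measurable_pastI: "(\<And>S. X -` S \<inter> space M \<in> past_generators t) \<Longrightarrow>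
    X \<in> measurable (past t) (count_space UNIV)"
  by (rule measurableI) (auto simp: sets_past)

lemma measurable_A_past: "A i s \<in> measurable (past t) (count_space UNIV)"
  by (rule measurable_pastI) (use process_events_vimage[of "A i" s] in \<open>auto simp: past_generators_def\<close>)

lemma measurable_C_past: "s < t \<Longrightarrow> C i s \<in> measurable (past t) (count_space UNIV)"
  by (rule measurable_pastI) (auto simp: past_generators_def slot_events_def)

lemma measurable_internal_past:
  "seed \<in> measurable (past t) R"
  "m 0 \<in> measurable (past t) (count_space UNIV)"
  "Q i 0 \<in> measurable (past t) (count_space UNIV)"
proof -
  let ?N = "R \<Otimes>\<^sub>M count_space UNIV \<Otimes>\<^sub>M count_space UNIV"
  let ?f = "\<lambda>\<omega>. (seed \<omega>, m 0 \<omega>, \<lambda>i. Q i 0 \<omega>)"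
  have "?f \<in> measurable (vimage_algebra (space M) ?f ?N) ?N"
    using measurable_space[OF measurable_seed]
    by (intro measurable_vimage_algebra1) (auto simp: space_pair_measure)
  then have f: "?f \<in> measurable (past t) ?N"
    by (auto simp: measurable_def sets_past past_generators_def internal_events_def
        intro!: sigma_sets.Basic)
  from measurable_compose[OF f measurable_fst] show "seed \<in> measurable (past t) R" by simp
  from measurable_compose[OF measurable_compose[OF f measurable_snd] measurable_fst]
  show "m 0 \<in> measurable (past t) (count_space UNIV)" by simp
  from measurable_compose[OF measurable_compose[OF f measurable_snd] measurable_snd]
  have "(\<lambda>\<omega> i. Q i 0 \<omega>) \<in> measurable (past t) (count_space UNIV)" by simp
  from measurable_compose[OF this, of "\<lambda>f. f i"]
  show "Q i 0 \<in> measurable (past t) (count_space UNIV)" by simp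
qed

text \<open>The action in slot \<open>t\<close> sees the channels of slot \<open>t\<close>, so it belongs to the next past only.\<close>

lemma measurable_act_past:
  assumes "\<And>s. s \<le> t \<Longrightarrow> m s \<in> measurable (past (Suc t)) (count_space UNIV)"
    and "\<And>i s. s \<le> t \<Longrightarrow> Q i s \<in> measurable (past (Suc t)) (count_space UNIV)"
  shows "act t \<in> measurable (past (Suc t)) (count_space UNIV)"
proof -
  let ?N = "past (Suc t)"
  let ?obs = "\<lambda>s \<omega>. (m s \<omega>, (\<lambda>i. Q i s \<omega>), (\<lambda>i. C i s \<omega>))"
  have "?obs s \<in> measurable ?N (count_space UNIV)" if "s \<le> t" for s
    using that assms
    by (intro measurable_countable_app2[where h=Pair] measurable_countable_fun measurable_C_past) auto
  then have hist: "(\<lambda>\<omega>. map (\<lambda>s. ?obs s \<omega>) [0..<Suc t]) \<in> measurable ?N (count_space UNIV)"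
    by (intro measurable_countable_map[where X="?obs"]) auto
  have "(\<lambda>\<omega>. pol (seed \<omega>) (map (\<lambda>s. ?obs s \<omega>) [0..<Suc t])) \<in> measurable ?N (count_space UNIV)"
    by (rule measurable_compose_countable[OF _ hist])
      (rule measurable_compose[OF measurable_internal_past(1) measurable_pol])
  then show ?thesis
    by (rule measurable_cong[THEN iffD2, rotated]) (simp add: act_eq)
qed

text \<open>The position in slot \<open>t\<close> is determined before the channels of that slot are drawn. This is
  how causality of the policy enters the argument.\<close>

lemma measurable_state_past:
  "m t \<in> measurable (past t) (count_space UNIV) \<and> (\<forall>i. Q i t \<in> measurable (past t) (count_space UNIV))"
proof (induction t rule: less_induct)
  case (less t)
  show ?case
  proof (cases t)
    case 0
    then show ?thesis using measurable_internal_past by auto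
  next
    case (Suc s)
    let ?N = "past (Suc s)"
    have mM: "m r \<in> measurable ?N (count_space UNIV)" "Q i r \<in> measurable ?N (count_space UNIV)"
      if "r \<le> s" for i r
      using less[of r] that Suc measurable_past_mono[of r "Suc s"] by auto
    note act = measurable_act_past[of s, OF mM]
    have C: "C i s \<in> measurable ?N (count_space UNIV)" for i
      by (rule measurable_C_past) simp
    have "(\<lambda>\<omega>. if act s \<omega> then m s \<omega> else other (m s \<omega>)) \<in> measurable ?N (count_space UNIV)"
      using measurable_countable_app2[OF act mM(1)[of s],
          where h="\<lambda>a q. if a then q else other q"] by simp
    then have 1: "m (Suc s) \<in> measurable ?N (count_space UNIV)"
      by (rule measurable_cong[THEN iffD2, rotated]) (simp add: m_Suc)
    have D: "D i s \<in> measurable ?N (count_space UNIV)" for i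
    proof -
      have "(\<lambda>\<omega>. (m s \<omega>, act s \<omega>, C i s \<omega>, Q i s \<omega>)) \<in> measurable ?N (count_space UNIV)"
        using mM act C by (intro measurable_countable_app2[where h=Pair]) auto
      from measurable_compose[OF this measurable_count_space]
      have "(\<lambda>\<omega>. (\<lambda>(q, a, c, n). of_bool (q = i \<and> a \<and> c \<and> n > 0) :: nat) (m s \<omega>, act s \<omega>, C i s \<omega>, Q i s \<omega>))
          \<in> measurable ?N (count_space UNIV)" .
      then have "(\<lambda>\<omega>. of_bool (m s \<omega> = i \<and> act s \<omega> \<and> C i s \<omega> \<and> Q i s \<omega> > 0) :: nat)
          \<in> measurable ?N (count_space UNIV)" by (simp only: prod.case)
      then show ?thesis by (rule measurable_cong[THEN iffD2, rotated]) (simp add: D_eq)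
    qed
    have "Q i (Suc s) \<in> measurable ?N (count_space UNIV)" for i
    proof -
      have "(\<lambda>\<omega>. Q i s \<omega> + A i s \<omega> - D i s \<omega>) \<in> measurable ?N (count_space UNIV)"
        using measurable_countable_app2[OF measurable_countable_app2[OF mM(2)[of s i] measurable_A_past,
            where h="(+)"] D, where h="(-)"] by simp
      then show ?thesis by (rule measurable_cong[THEN iffD2, rotated]) (simp add: Q_Suc)
    qed
    with 1 show ?thesis using Suc by simp
  qed
qed

lemma measurable_m_past: "m t \<in> measurable (past t) (count_space UNIV)"
  and measurable_Q_past: "Q i t \<in> measurable (past t) (count_space UNIV)"
  using measurable_state_past by auto

lemma measurable_C: "C i t \<in> measurable M (count_space UNIV)"
  using measurable_C_past[of t "Suc t"] measurable_past_events by blast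

lemma expectation_channel:
  fixes h :: "bool \<Rightarrow> real"
  shows "expectation (\<lambda>\<omega>. h (C i t \<omega>)) = p i * h True + (1 - p i) * h False"
proof -
  have S: "{\<omega> \<in> space M. C i t \<omega>} \<in> events"
    using measurable_C[of i t] by measurable
  have "expectation (\<lambda>\<omega>. h (C i t \<omega>)) =
      expectation (\<lambda>\<omega>. h False + (h True - h False) * indicator {\<omega> \<in> space M. C i t \<omega>} \<omega>)"
    by (rule Bochner_Integration.integral_cong) (auto simp: indicator_def)
  also have "\<dots> = h False + (h True - h False) * p i"
    using S prob_C[of i t] by (subst Bochner_Integration.integral_add) (auto simp: prob_space integrable_indicator_iff emeasure_eq_measure)
  finally show ?thesis by (simp add: algebra_simps)
qed

lemma expectation_past_times_channel:
  fixes h :: "bool \<Rightarrow> real"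
  assumes Z: "Z \<in> borel_measurable (past t)" and int: "integrable M Z"
  shows "expectation (\<lambda>\<omega>. Z \<omega> * h (C i t \<omega>))
    = expectation Z * (p i * h True + (1 - p i) * h False)"
proof -
  have hm: "(\<lambda>\<omega>. h (C i t \<omega>)) \<in> borel_measurable M"
    by (rule measurable_compose[OF measurable_C]) simp
  have inth: "integrable M (\<lambda>\<omega>. h (C i t \<omega>))"
    by (rule integrable_const_bound[where B="max \<bar>h True\<bar> \<bar>h False\<bar>", OF _ hm])
      (rule AE_I2, case_tac "C i t x", auto)
  have "{Z -` S \<inter> space M | S. S \<in> sets borel} \<subseteq> sets (past t)"
    using measurable_sets[OF Z] by auto
  from sets.sigma_sets_subset[OF this]
  have "sigma_sets (space M) {Z -` S \<inter> space M | S. S \<in> sets borel} \<subseteq> sets (past t)"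
    by simp
  moreover have "(\<lambda>\<omega>. h (C i t \<omega>)) -` S \<inter> space M \<in> slot_events i t" for S
    unfolding slot_events_def by (auto intro!: exI[of _ "h -` S"])
  then have "sigma_sets (space M) {(\<lambda>\<omega>. h (C i t \<omega>)) -` S \<inter> space M | S. S \<in> sets borel}
      \<subseteq> sigma_sets (space M) (slot_events i t)"
    by (intro sigma_sets_mono') auto
  ultimately have "indep_var borel Z borel (\<lambda>\<omega>. h (C i t \<omega>))"
    using indep_past_slot[of t i] hm measurable_past_events[OF Z]
    unfolding indep_var_eq indep_sets2_eq by blast
  from indep_var_lebesgue_integral[OF this int inth] show ?thesis
    by (simp add: expectation_channel)
qed

text \<open>The index of the served channel is itself random, but it belongs to the past. Splitting over its two
  values reduces to a channel with fixed index, whose state can be integrated out.\<close>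

lemma expectation_past_times_served_channel:
  fixes g :: "queue \<Rightarrow> bool \<Rightarrow> real"
  assumes Y: "Y \<in> borel_measurable (past t)" and bound: "\<And>\<omega>. \<omega> \<in> space M \<Longrightarrow> \<bar>Y \<omega>\<bar> \<le> c"
  shows "expectation (\<lambda>\<omega>. Y \<omega> * g (m t \<omega>) (C (m t \<omega>) t \<omega>)) =
    expectation (\<lambda>\<omega>. Y \<omega> * (p (m t \<omega>) * g (m t \<omega>) True + (1 - p (m t \<omega>)) * g (m t \<omega>) False))"
proof -
  define Z where "Z i \<omega> = Y \<omega> * of_bool (m t \<omega> = i)" for i \<omega>
  define v where "v i = p i * g i True + (1 - p i) * g i False" for i
  have Zm: "Z i \<in> borel_measurable (past t)" for i
  proof -
    have "(\<lambda>\<omega>. of_bool (m t \<omega> = i) :: real) \<in> borel_measurable (past t)"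
      by (rule measurable_compose[OF measurable_m_past]) simp
    then show ?thesis unfolding Z_def using Y by measurable
  qed
  have Zb: "\<bar>Z i \<omega>\<bar> \<le> c" if "\<omega> \<in> space M" for i \<omega>
    using bound[OF that] by (auto simp: Z_def)
  have intZ: "integrable M (Z i)" for i
    by (rule integrable_const_bound[where B=c]) (auto simp: Zb intro: measurable_past_events[OF Zm])
  have intZg: "integrable M (\<lambda>\<omega>. Z i \<omega> * g i (C i t \<omega>))" for i
  proof (rule integrable_const_bound[where B="c * max \<bar>g i True\<bar> \<bar>g i False\<bar>"])
    have "\<bar>g i b\<bar> \<le> max \<bar>g i True\<bar> \<bar>g i False\<bar>" for b by (cases b) auto
    then show "AE \<omega> in M. norm (Z i \<omega> * g i (C i t \<omega>)) \<le> c * max \<bar>g i True\<bar> \<bar>g i False\<bar>"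
      by (intro AE_I2) (auto simp: abs_mult intro!: mult_mono Zb order_trans[OF abs_ge_zero Zb])
    have "(\<lambda>\<omega>. g i (C i t \<omega>)) \<in> borel_measurable M"
      by (rule measurable_compose[OF measurable_C]) simp
    then show "(\<lambda>\<omega>. Z i \<omega> * g i (C i t \<omega>)) \<in> borel_measurable M"
      using measurable_past_events[OF Zm] by measurable
  qed
  have "expectation (\<lambda>\<omega>. Y \<omega> * g (m t \<omega>) (C (m t \<omega>) t \<omega>))
      = expectation (\<lambda>\<omega>. \<Sum>i\<in>UNIV. Z i \<omega> * g i (C i t \<omega>))"
  proof (rule Bochner_Integration.integral_cong)
    fix \<omega> show "Y \<omega> * g (m t \<omega>) (C (m t \<omega>) t \<omega>) = (\<Sum>i\<in>UNIV. Z i \<omega> * g i (C i t \<omega>))"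
      by (cases "m t \<omega>") (auto simp: UNIV_queue Z_def)
  qed simp
  also have "\<dots> = (\<Sum>i\<in>UNIV. expectation (Z i) * v i)"
    by (simp add: Bochner_Integration.integral_sum intZg v_def
        expectation_past_times_channel[OF Zm intZ])
  also have "\<dots> = expectation (\<lambda>\<omega>. \<Sum>i\<in>UNIV. Z i \<omega> * v i)"
    using intZ by (simp add: Bochner_Integration.integral_sum)
  also have "\<dots> = expectation (\<lambda>\<omega>. Y \<omega> * v (m t \<omega>))"
  proof (rule Bochner_Integration.integral_cong)
    fix \<omega> show "(\<Sum>i\<in>UNIV. Z i \<omega> * v i) = Y \<omega> * v (m t \<omega>)"
      by (cases "m t \<omega>") (auto simp: UNIV_queue Z_def)
  qed simp
  finally show ?thesis by (simp add: v_def)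
qed

end

section \<open>The channel noise as a martingale\<close>

lemma (in prob_space) integrable_bounded:
  fixes f :: "'a \<Rightarrow> real"
  assumes "f \<in> borel_measurable M" "\<And>\<omega>. \<omega> \<in> space M \<Longrightarrow> \<bar>f \<omega>\<bar> \<le> c"
  shows "integrable M f"
  using assms by (intro integrable_const_bound[where B=c] AE_I2) auto

text \<open>This inequality turns a lower bound on the second moment and an upper bound on the fourth into a lower
  bound on the first absolute moment; the scale \<open>a\<close> is to be chosen afterwards.\<close>

lemma abs_ge_quadratic_minus_quartic:
  fixes x a :: real
  assumes "a > 0"
  shows "x\<^sup>2 / a - x ^ 4 / a ^ 3 \<le> \<bar>x\<bar>"
proof -
  define y where "y = \<bar>x\<bar> / a"
  have x: "\<bar>x\<bar> = a * y" and y: "y \<ge> 0" using assms by (simp_all add: y_def)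
  have "1 - y + y ^ 3 \<ge> 0"
  proof (cases "y \<le> 1")
    case False
    then have "y ^ 1 \<le> y ^ 3" by (intro power_increasing) auto
    then show ?thesis by simp
  qed (use y in auto)
  then have "0 \<le> a * (y * (1 - y + y ^ 3))" using y assms by simp
  then have "a * y\<^sup>2 - a * y ^ 4 \<le> \<bar>x\<bar>"
    unfolding x by (simp add: algebra_simps power2_eq_square power3_eq_cube power4_eq_xxxx)
  moreover have "x\<^sup>2 / a = a * y\<^sup>2"
    using assms by (simp add: y_def power_divide power2_eq_square)
  moreover have "x ^ 4 / a ^ 3 = a * y ^ 4"
    using assms by (simp add: y_def power_divide power_even_abs power3_eq_cube power4_eq_xxxx)
  ultimately show ?thesis by simp
qed

locale nondegenerate_two_queue_system = two_queue_system +
  assumes p_bounds: "\<And>i. 0 < p i \<and> p i < 1"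
begin

text \<open>A crude bound on both \<open>1 / p i\<close>; it bounds the noise and the work that one packet
  represents.\<close>

definition \<beta> :: real where "\<beta> = 1 / p Queue1 + 1 / p Queue2"

text \<open>The smaller of the two variances \<open>(1 - p i) / p i\<close> of \<open>C i t / p i\<close>.\<close>

definition \<nu> :: real where "\<nu> = min (1 / p Queue1 - 1) (1 / p Queue2 - 1)"

text \<open>The shortfall, against its mean one, of the work that the server could do in slot \<open>t\<close> at its
  current position. It is charged even when the server switches or finds the queue empty.\<close>

definition noise :: "nat \<Rightarrow> 'a \<Rightarrow> real" where
  "noise t \<omega> = 1 - of_bool (C (m t \<omega>) t \<omega>) / p (m t \<omega>)"

definition walk :: "nat \<Rightarrow> 'a \<Rightarrow> real" where
  "walk t \<omega> = (\<Sum>s<t. noise s \<omega>)"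

lemma inverse_p_le_\<beta>: "1 / p i \<le> \<beta>"
  using p_bounds[of Queue1] p_bounds[of Queue2] by (cases i) (auto simp: \<beta>_def)

lemma \<beta>_gt_1: "\<beta> > 1"
proof -
  have "1 < 1 / p Queue1" using p_bounds[of Queue1] by simp
  then show ?thesis using inverse_p_le_\<beta>[of Queue1] by simp
qed

lemma \<nu>_pos: "\<nu> > 0"
  using p_bounds by (simp add: \<nu>_def)

lemma \<nu>_le: "\<nu> \<le> 1 / p i - 1"
  by (cases i) (auto simp: \<nu>_def)

lemma abs_noise_le: "\<bar>noise t \<omega>\<bar> \<le> \<beta>"
  using p_bounds[of "m t \<omega>"] inverse_p_le_\<beta>[of "m t \<omega>"] \<beta>_gt_1 by (auto simp: noise_def)

lemma measurable_noise_past: "noise t \<in> borel_measurable (past (Suc t))"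
proof -
  have m: "m t \<in> measurable (past (Suc t)) (count_space UNIV)"
    by (rule measurable_past_mono[OF _ measurable_m_past]) simp
  have "(\<lambda>\<omega>. C (m t \<omega>) t \<omega>) \<in> measurable (past (Suc t)) (count_space UNIV)"
    by (rule measurable_compose_countable[OF measurable_C_past m]) simp
  from measurable_compose[OF measurable_countable_app2[OF m this, where h=Pair],
      of "\<lambda>(i, c). 1 - of_bool c / p i" borel]
  show ?thesis unfolding noise_def by (simp only: prod.case measurable_count_space_eq1
      space_count_space Pi_UNIV UNIV_I space_borel)
qed

lemma measurable_walk_past: "walk t \<in> borel_measurable (past t)"
  unfolding walk_def
  by (intro borel_measurable_sum measurable_past_mono[OF _ measurable_noise_past]) auto

lemma measurable_noise [measurable]: "noise t \<in> borel_measurable M"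
  and measurable_walk [measurable]: "walk t \<in> borel_measurable M"
  using measurable_noise_past measurable_walk_past measurable_past_events by blast+

lemma abs_walk_le: "\<bar>walk t \<omega>\<bar> \<le> \<beta> * t"
proof -
  have "\<bar>walk t \<omega>\<bar> \<le> (\<Sum>s<t. \<bar>noise s \<omega>\<bar>)" unfolding walk_def by (rule sum_abs)
  also have "\<dots> \<le> (\<Sum>s<t. \<beta>)" by (intro sum_mono abs_noise_le)
  finally show ?thesis by (simp add: mult.commute)
qed

lemma expectation_past_times_noise:
  assumes "Y \<in> borel_measurable (past t)" "\<And>\<omega>. \<omega> \<in> space M \<Longrightarrow> \<bar>Y \<omega>\<bar> \<le> c"
  shows "expectation (\<lambda>\<omega>. Y \<omega> * noise t \<omega>) = 0"
proof -
  have "p i * (1 - 1 / p i) + (1 - p i) = 0" for i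
    using p_bounds[of i] by (simp add: field_simps)
  then show ?thesis
    using expectation_past_times_served_channel[OF assms, of "\<lambda>i c. 1 - of_bool c / p i"]
    by (simp add: noise_def)
qed

lemma expectation_noise_squared: "expectation (\<lambda>\<omega>. (noise t \<omega>)\<^sup>2) \<ge> \<nu>"
proof -
  have var: "p i * (1 - 1 / p i)\<^sup>2 + (1 - p i) = 1 / p i - 1" for i
    using p_bounds[of i] by (simp add: field_simps power2_eq_square)
  have meas: "(\<lambda>\<omega>. 1 / p (m t \<omega>) - 1) \<in> borel_measurable M"
    by (rule measurable_compose[OF measurable_past_events[OF measurable_m_past]]) simp
  have "\<nu> = expectation (\<lambda>\<omega>. \<nu>)" by (simp add: prob_space)
  also have "\<dots> \<le> expectation (\<lambda>\<omega>. 1 / p (m t \<omega>) - 1)"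
  proof (rule integral_mono)
    show "integrable M (\<lambda>\<omega>. 1 / p (m t \<omega>) - 1)"
    proof (rule integrable_bounded[OF meas])
      show "\<bar>1 / p (m t \<omega>) - 1\<bar> \<le> \<beta>" for \<omega>
        using \<nu>_pos \<nu>_le[of "m t \<omega>"] inverse_p_le_\<beta>[of "m t \<omega>"] by auto
    qed
  qed (auto simp: \<nu>_le)
  also have "\<dots> = expectation (\<lambda>\<omega>. (noise t \<omega>)\<^sup>2)"
    using expectation_past_times_served_channel[of "\<lambda>_. 1" t 1 "\<lambda>i c. (1 - of_bool c / p i)\<^sup>2"]
    by (simp add: noise_def var)
  finally show ?thesis .
qed

lemma integrable_walk_power: "integrable M (\<lambda>\<omega>. walk t \<omega> ^ k)"
  by (rule integrable_bounded[where c="(\<beta> * t) ^ k"])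
    (auto simp: power_abs intro!: power_mono abs_walk_le)

lemma integrable_walk_power_noise: "integrable M (\<lambda>\<omega>. walk t \<omega> ^ k * noise t \<omega> ^ l)"
  by (rule integrable_bounded[where c="(\<beta> * t) ^ k * \<beta> ^ l"])
    (use \<beta>_gt_1 in \<open>auto simp: power_abs abs_mult intro!: mult_mono power_mono abs_walk_le abs_noise_le\<close>)

lemma integrable_walk: "integrable M (walk t)"
  using integrable_walk_power[of t 1] by simp

lemma expectation_walk_power_noise: "expectation (\<lambda>\<omega>. walk t \<omega> ^ k * noise t \<omega>) = 0"
proof (rule expectation_past_times_noise)
  show "(\<lambda>\<omega>. walk t \<omega> ^ k) \<in> borel_measurable (past t)"
    using measurable_walk_past by measurable
  show "\<bar>walk t \<omega> ^ k\<bar> \<le> (\<beta> * t) ^ k" for \<omega>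
    by (auto simp: power_abs intro!: power_mono abs_walk_le)
qed

text \<open>Increments of a martingale are orthogonal.\<close>

lemma expectation_walk_squared_Suc:
  "expectation (\<lambda>\<omega>. (walk (Suc t) \<omega>)\<^sup>2)
    = expectation (\<lambda>\<omega>. (walk t \<omega>)\<^sup>2) + expectation (\<lambda>\<omega>. (noise t \<omega>)\<^sup>2)"
proof -
  have "(\<lambda>\<omega>. (walk (Suc t) \<omega>)\<^sup>2)
      = (\<lambda>\<omega>. (walk t \<omega>)\<^sup>2 + 2 * (walk t \<omega> * noise t \<omega>) + (noise t \<omega>)\<^sup>2)"
    by (auto simp: walk_def power2_eq_square algebra_simps)
  then show ?thesis
    using integrable_walk_power[of t 2] integrable_walk_power_noise[of t 1 1]
      integrable_walk_power_noise[of t 0 2] expectation_walk_power_noise[of t 1]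
    by simp
qed

lemma expectation_walk_squared_ge: "\<nu> * t \<le> expectation (\<lambda>\<omega>. (walk t \<omega>)\<^sup>2)"
proof (induction t)
  case (Suc t)
  then show ?case
    using expectation_noise_squared[of t] by (simp add: expectation_walk_squared_Suc algebra_simps)
qed (simp add: walk_def)

lemma expectation_walk_squared_le: "expectation (\<lambda>\<omega>. (walk t \<omega>)\<^sup>2) \<le> \<beta>\<^sup>2 * t"
proof (induction t)
  case (Suc t)
  have "expectation (\<lambda>\<omega>. (noise t \<omega>)\<^sup>2) \<le> expectation (\<lambda>\<omega>. \<beta>\<^sup>2)"
    using integrable_walk_power_noise[of t 0 2]
    by (intro integral_mono) (auto intro: power2_le_iff_abs_le[THEN iffD2] simp: abs_noise_le
        abs_le_square_iff[symmetric] intro!: order_trans[OF abs_noise_le])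
  with Suc show ?case
    by (simp add: expectation_walk_squared_Suc algebra_simps prob_space)
qed (simp add: walk_def)

text \<open>In the expansion of \<open>(x + n) ^ 4\<close> the term linear in \<open>n\<close> integrates to zero and the cubic one is
  absorbed by its even neighbours, so one step adds at most a multiple of the second moment, which grows
  linearly.\<close>

lemma expectation_walk_fourth_le: "expectation (\<lambda>\<omega>. walk t \<omega> ^ 4) \<le> 4 * \<beta> ^ 4 * (real t)\<^sup>2"
proof (induction t)
  case (Suc t)
  have pointwise: "(x + n) ^ 4 \<le> x ^ 4 + 4 * (x ^ 3 * n) + 8 * \<beta>\<^sup>2 * x\<^sup>2 + 3 * \<beta> ^ 4"
    if n: "\<bar>n\<bar> \<le> \<beta>" for x n :: real
  proof -
    have n2: "n\<^sup>2 \<le> \<beta>\<^sup>2" using n by (simp add: abs_le_square_iff[symmetric])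
    have n4: "n ^ 4 \<le> \<beta> ^ 4" using power_mono[OF n2, of 2] by simp
    \<comment> \<open>This square is the bound \<open>4 x n\<^sup>3 \<le> 2 n\<^sup>2 (x\<^sup>2 + n\<^sup>2)\<close>.\<close>
    have "0 \<le> 2 * n\<^sup>2 * (x - n)\<^sup>2" by simp
    then have "(x + n) ^ 4 \<le> x ^ 4 + 4 * (x ^ 3 * n) + 8 * (n\<^sup>2 * x\<^sup>2) + 3 * n ^ 4"
      by (simp add: power2_eq_square power3_eq_cube power4_eq_xxxx algebra_simps)
    moreover have "n\<^sup>2 * x\<^sup>2 \<le> \<beta>\<^sup>2 * x\<^sup>2" using n2 by (simp add: mult_right_mono)
    ultimately show ?thesis using n4 by linarith
  qed
  have int: "integrable M (\<lambda>\<omega>. walk t \<omega> ^ 4)" "integrable M (\<lambda>\<omega>. walk t \<omega> ^ 3 * noise t \<omega>)"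
    "integrable M (\<lambda>\<omega>. (walk t \<omega>)\<^sup>2)"
    using integrable_walk_power[of t] integrable_walk_power_noise[of t 3 1] by auto
  have "expectation (\<lambda>\<omega>. walk (Suc t) \<omega> ^ 4)
      \<le> expectation (\<lambda>\<omega>. walk t \<omega> ^ 4 + 4 * (walk t \<omega> ^ 3 * noise t \<omega>)
          + 8 * \<beta>\<^sup>2 * (walk t \<omega>)\<^sup>2 + 3 * \<beta> ^ 4)"
  proof (rule integral_mono[OF integrable_walk_power])
    show "walk (Suc t) \<omega> ^ 4 \<le> walk t \<omega> ^ 4 + 4 * (walk t \<omega> ^ 3 * noise t \<omega>)
        + 8 * \<beta>\<^sup>2 * (walk t \<omega>)\<^sup>2 + 3 * \<beta> ^ 4" for \<omega>
      using pointwise[OF abs_noise_le, of "walk t \<omega>" t \<omega>] by (simp add: walk_def)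
  qed (use int in simp)
  also have "\<dots> = expectation (\<lambda>\<omega>. walk t \<omega> ^ 4) + 8 * \<beta>\<^sup>2 * expectation (\<lambda>\<omega>. (walk t \<omega>)\<^sup>2) + 3 * \<beta> ^ 4"
    using int expectation_walk_power_noise[of t 3] by (simp add: prob_space)
  also have "\<dots> \<le> 4 * \<beta> ^ 4 * (real t)\<^sup>2 + 8 * \<beta>\<^sup>2 * (\<beta>\<^sup>2 * t) + 3 * \<beta> ^ 4"
    using Suc expectation_walk_squared_le[of t] by (intro add_mono mult_left_mono) auto
  also have "\<dots> \<le> 4 * \<beta> ^ 4 * (real (Suc t))\<^sup>2"
    using \<beta>_gt_1 by (simp add: power2_eq_square power4_eq_xxxx algebra_simps)
  finally show ?case .
qed (simp add: walk_def)

lemma expectation_abs_walk_ge: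
  obtains \<kappa> where "\<kappa> > 0" "\<And>t. \<kappa> * sqrt t \<le> expectation (\<lambda>\<omega>. \<bar>walk t \<omega>\<bar>)"
proof
  \<comment> \<open>With \<open>a = K * sqrt t\<close> the moment bounds give \<open>(\<nu> / K - 4 * \<beta> ^ 4 / K ^ 3) * sqrt t\<close>;
    this \<open>K\<close> makes the second term half of the first.\<close>
  define K where "K = sqrt (8 * \<beta> ^ 4 / \<nu>)"
  have K: "K > 0" "K\<^sup>2 = 8 * \<beta> ^ 4 / \<nu>"
    using \<beta>_gt_1 \<nu>_pos by (auto simp: K_def)
  show "\<nu> / (2 * K) > 0" using K \<nu>_pos by simp
  fix t :: nat
  show "\<nu> / (2 * K) * sqrt t \<le> expectation (\<lambda>\<omega>. \<bar>walk t \<omega>\<bar>)"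
  proof (cases "t = 0")
    case False
    define r where "r = sqrt (real t)"
    define a where "a = K * r"
    have r: "r > 0" "real t = r\<^sup>2" using False by (auto simp: r_def)
    have a: "a > 0" using K r by (simp add: a_def)
    have "\<nu> / (2 * K) * r = \<nu> * r\<^sup>2 / a - 4 * \<beta> ^ 4 * (r\<^sup>2)\<^sup>2 / a ^ 3"
    proof -
      have "4 * \<beta> ^ 4 = \<nu> * K\<^sup>2 / 2" using K \<nu>_pos by simp
      then show ?thesis using K(1) r(1)
        by (simp add: a_def field_simps power2_eq_square power3_eq_cube)
    qed
    also have "\<dots> \<le> expectation (\<lambda>\<omega>. (walk t \<omega>)\<^sup>2) / a - expectation (\<lambda>\<omega>. walk t \<omega> ^ 4) / a ^ 3"
      using expectation_walk_squared_ge[of t] expectation_walk_fourth_le[of t] a r(2)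
      by (intro diff_mono divide_right_mono) auto
    also have "\<dots> = expectation (\<lambda>\<omega>. (walk t \<omega>)\<^sup>2 / a - walk t \<omega> ^ 4 / a ^ 3)"
      using integrable_walk_power[of t] by simp
    also have "\<dots> \<le> expectation (\<lambda>\<omega>. \<bar>walk t \<omega>\<bar>)"
      using integrable_walk_power[of t] integrable_walk[of t] a
      by (intro integral_mono abs_ge_quadratic_minus_quartic) auto
    finally show ?thesis by (simp add: r_def)
  qed (simp add: walk_def)
qed

section \<open>Backlog under full load\<close>

definition \<rho> :: real where "\<rho> = lam Queue1 / p Queue1 + lam Queue2 / p Queue2"

definition load :: "nat \<Rightarrow> 'a \<Rightarrow> real" where
  "load t \<omega> = (\<Sum>s<t. real (A Queue1 s \<omega>) / p Queue1 + real (A Queue2 s \<omega>) / p Queue2 - \<rho>)"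

lemma measurable_load_past: "load t \<in> borel_measurable (past s)"
proof -
  have "(\<lambda>\<omega>. real (A i r \<omega>)) \<in> borel_measurable (past s)" for i r
    by (rule measurable_compose[OF measurable_A_past]) simp
  then show ?thesis unfolding load_def by measurable
qed

lemma integrable_A: "integrable M (\<lambda>\<omega>. real (A i t \<omega>))"
proof (rule Bochner_Integration.integrable_bound)
  have [measurable]: "(\<lambda>\<omega>. real (A i t \<omega>)) \<in> borel_measurable M"
    by (rule measurable_compose[OF measurable_A]) simp
  show "(\<lambda>\<omega>. real (A i t \<omega>)) \<in> borel_measurable M" by measurable
  show "integrable M (\<lambda>\<omega>. (real (A i t \<omega>))\<^sup>2)"
    using second_moment_A[of i t]
    by (intro integrableI_nonneg) (auto intro: le_less_trans[OF _ ennreal_less_top])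
  have "real n \<le> (real n)\<^sup>2" for n
    by (cases n) (auto simp: power2_eq_square)
  then show "AE \<omega> in M. norm (real (A i t \<omega>)) \<le> norm ((real (A i t \<omega>))\<^sup>2)" by simp
qed

lemma integrable_load: "integrable M (load t)"
  unfolding load_def using integrable_A by simp

lemma expectation_load: "expectation (load t) = 0"
  unfolding load_def using integrable_A
  by (simp add: rate_A \<rho>_def prob_space)

lemma expectation_walk: "expectation (walk t) = 0"
proof -
  have "expectation (noise s) = 0" for s
    using expectation_walk_power_noise[of s 0] by simp
  moreover have "integrable M (noise s)" for s
    using integrable_walk_power_noise[of s 0 1] by simp
  ultimately show ?thesis
    unfolding walk_def by (simp add: Bochner_Integration.integral_sum)
qed

text \<open>Pointwise \<open>\<bar>l + w\<bar> \<ge> \<bar>l\<bar> + sgn l * w\<close>. The sign of \<open>load t\<close> depends on arrivals only, hence lies in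
  every past, so the second summand has expectation zero step by step.\<close>

lemma expectation_abs_load_le:
  "expectation (\<lambda>\<omega>. \<bar>load t \<omega>\<bar>) \<le> expectation (\<lambda>\<omega>. \<bar>load t \<omega> + walk t \<omega>\<bar>)"
proof -
  have sgn_past: "(\<lambda>\<omega>. sgn (load t \<omega>)) \<in> borel_measurable (past s)" for s
    using measurable_load_past[of t s] unfolding sgn_if by measurable
  have sgn_bound: "\<bar>sgn x\<bar> \<le> 1" for x :: real by (simp add: sgn_if)
  have int: "integrable M (\<lambda>\<omega>. sgn (load t \<omega>) * noise s \<omega>)" for s
  proof (rule integrable_bounded)
    show "(\<lambda>\<omega>. sgn (load t \<omega>) * noise s \<omega>) \<in> borel_measurable M"
      using measurable_past_events[OF sgn_past] by measurable
    show "\<bar>sgn (load t \<omega>) * noise s \<omega>\<bar> \<le> 1 * \<beta>" for \<omega>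
      unfolding abs_mult by (intro mult_mono sgn_bound abs_noise_le) auto
  qed
  have sw: "(\<lambda>\<omega>. sgn (load t \<omega>) * walk t \<omega>) = (\<lambda>\<omega>. \<Sum>s<t. sgn (load t \<omega>) * noise s \<omega>)"
    by (simp add: walk_def sum_distrib_left)
  have int': "integrable M (\<lambda>\<omega>. sgn (load t \<omega>) * walk t \<omega>)"
    unfolding sw using int by simp
  have zero: "expectation (\<lambda>\<omega>. sgn (load t \<omega>) * walk t \<omega>) = 0"
    unfolding sw using int
    by (simp add: Bochner_Integration.integral_sum
        expectation_past_times_noise[OF sgn_past sgn_bound])
  have "expectation (\<lambda>\<omega>. \<bar>load t \<omega>\<bar>) = expectation (\<lambda>\<omega>. \<bar>load t \<omega>\<bar> + sgn (load t \<omega>) * walk t \<omega>)"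
    using int' integrable_load zero by simp
  also have "\<dots> \<le> expectation (\<lambda>\<omega>. \<bar>load t \<omega> + walk t \<omega>\<bar>)"
    using int' integrable_load integrable_walk
    by (intro integral_mono) (auto simp: sgn_if)
  finally show ?thesis .
qed

lemma expectation_abs_walk_le:
  "expectation (\<lambda>\<omega>. \<bar>walk t \<omega>\<bar>) \<le> 2 * expectation (\<lambda>\<omega>. \<bar>load t \<omega> + walk t \<omega>\<bar>)"
proof -
  have "expectation (\<lambda>\<omega>. \<bar>walk t \<omega>\<bar>)
      \<le> expectation (\<lambda>\<omega>. \<bar>load t \<omega> + walk t \<omega>\<bar> + \<bar>load t \<omega>\<bar>)"
    using integrable_load integrable_walk by (intro integral_mono) auto
  also have "\<dots> = expectation (\<lambda>\<omega>. \<bar>load t \<omega> + walk t \<omega>\<bar>) + expectation (\<lambda>\<omega>. \<bar>load t \<omega>\<bar>)"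
    using integrable_load integrable_walk by simp
  finally show ?thesis using expectation_abs_load_le[of t] by simp
qed

text \<open>Departures can only fall short of the work that the served channel offers, so the backlog dominates
  arriving work minus offered work on every path, under every policy.\<close>

lemma backlog_ge:
  assumes "\<omega> \<in> space M"
  shows "load t \<omega> + walk t \<omega> + (\<rho> - 1) * t
    \<le> real (Q Queue1 t \<omega>) / p Queue1 + real (Q Queue2 t \<omega>) / p Queue2"
proof (induction t)
  case 0
  show ?case using p_bounds by (simp add: load_def walk_def less_imp_le)
next
  case (Suc t)
  \<comment> \<open>Truncated subtraction can only make the next queue length larger.\<close>
  have Q: "real (Q i (Suc t) \<omega>) / p i \<ge> real (Q i t \<omega>) / p i + real (A i t \<omega>) / p i - real (D i t \<omega>) / p i" for i
    using p_bounds[of i] by (simp add: Q_Suc[OF assms] diff_divide_distrib[symmetric]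
        add_divide_distrib[symmetric] divide_right_mono)
  have D: "real (D Queue1 t \<omega>) / p Queue1 + real (D Queue2 t \<omega>) / p Queue2
      \<le> of_bool (C (m t \<omega>) t \<omega>) / p (m t \<omega>)"
    using p_bounds[of Queue1] p_bounds[of Queue2]
    by (cases "m t \<omega>") (auto simp: D_eq[OF assms])
  have "load (Suc t) \<omega> + walk (Suc t) \<omega> + (\<rho> - 1) * Suc t
      = load t \<omega> + walk t \<omega> + (\<rho> - 1) * t + real (A Queue1 t \<omega>) / p Queue1
        + real (A Queue2 t \<omega>) / p Queue2 - of_bool (C (m t \<omega>) t \<omega>) / p (m t \<omega>)"
    by (simp add: load_def walk_def noise_def algebra_simps)
  then show ?case using Suc D Q[of Queue1] Q[of Queue2] by linarith
qed

text \<open>The backlog is nonnegative, so it dominates the positive part of \<open>load t + walk t\<close>.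
  As both partial sums have mean zero, the expectation of that part is half the expected modulus.\<close>

lemma expected_backlog_ge:
  assumes "\<rho> \<ge> 1"
  shows "ennreal (expectation (\<lambda>\<omega>. \<bar>walk t \<omega>\<bar>) / 4)
    \<le> ennreal \<beta> * ((\<integral>\<^sup>+\<omega>. of_nat (Q Queue1 t \<omega>) \<partial>M) + (\<integral>\<^sup>+\<omega>. of_nat (Q Queue2 t \<omega>) \<partial>M))"
proof -
  let ?Y = "\<lambda>\<omega>. load t \<omega> + walk t \<omega>"
  have meas [measurable]: "Q i t \<in> measurable M (count_space UNIV)" for i
    using measurable_past_events[OF measurable_Q_past] .
  have int: "integrable M ?Y" using integrable_load integrable_walk by simp
  have "expectation (\<lambda>\<omega>. \<bar>walk t \<omega>\<bar>) / 4 \<le> expectation (\<lambda>\<omega>. \<bar>?Y \<omega>\<bar>) / 2"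
    using expectation_abs_walk_le[of t] by simp
  also have "\<dots> = expectation (\<lambda>\<omega>. (\<bar>?Y \<omega>\<bar> + ?Y \<omega>) / 2)"
    using int integrable_load integrable_walk by (simp add: expectation_load expectation_walk)
  finally have "ennreal (expectation (\<lambda>\<omega>. \<bar>walk t \<omega>\<bar>) / 4)
      \<le> ennreal (expectation (\<lambda>\<omega>. (\<bar>?Y \<omega>\<bar> + ?Y \<omega>) / 2))"
    by (rule ennreal_leI)
  also have "\<dots> = (\<integral>\<^sup>+\<omega>. ennreal ((\<bar>?Y \<omega>\<bar> + ?Y \<omega>) / 2) \<partial>M)"
    using int by (intro nn_integral_eq_integral[symmetric]) auto
  also have "\<dots> \<le> (\<integral>\<^sup>+\<omega>. ennreal \<beta> * (of_nat (Q Queue1 t \<omega>) + of_nat (Q Queue2 t \<omega>)) \<partial>M)"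
  proof (rule nn_integral_mono)
    fix \<omega> assume \<omega>: "\<omega> \<in> space M"
    have *: "real (Q i t \<omega>) / p i \<le> \<beta> * real (Q i t \<omega>)" for i
      using mult_right_mono[OF inverse_p_le_\<beta>[of i], of "real (Q i t \<omega>)"] by simp
    have "?Y \<omega> \<le> ?Y \<omega> + (\<rho> - 1) * t" using assms by simp
    also have "\<dots> \<le> \<beta> * real (Q Queue1 t \<omega>) + \<beta> * real (Q Queue2 t \<omega>)"
      using backlog_ge[OF \<omega>, of t] *[of Queue1] *[of Queue2] by linarith
    finally have "(\<bar>?Y \<omega>\<bar> + ?Y \<omega>) / 2 \<le> \<beta> * (real (Q Queue1 t \<omega>) + real (Q Queue2 t \<omega>))"
      using \<beta>_gt_1 by (auto simp: abs_if algebra_simps)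
    then have "ennreal ((\<bar>?Y \<omega>\<bar> + ?Y \<omega>) / 2)
        \<le> ennreal (\<beta> * (real (Q Queue1 t \<omega>) + real (Q Queue2 t \<omega>)))"
      by (rule ennreal_leI)
    also have "\<dots> = ennreal \<beta> * (of_nat (Q Queue1 t \<omega>) + of_nat (Q Queue2 t \<omega>))"
      using \<beta>_gt_1 by (simp add: ennreal_mult ennreal_plus ennreal_of_nat_eq_real_of_nat)
    finally show "ennreal ((\<bar>?Y \<omega>\<bar> + ?Y \<omega>) / 2)
        \<le> ennreal \<beta> * (of_nat (Q Queue1 t \<omega>) + of_nat (Q Queue2 t \<omega>))" .
  qed
  also have "\<dots> = ennreal \<beta> * ((\<integral>\<^sup>+\<omega>. of_nat (Q Queue1 t \<omega>) \<partial>M) + (\<integral>\<^sup>+\<omega>. of_nat (Q Queue2 t \<omega>) \<partial>M))"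
    by (subst nn_integral_cmult) (auto simp: nn_integral_add)
  finally show ?thesis .
qed

end

section \<open>Strong stability forbids growth of order square root\<close>

lemma eventually_sum_le_of_strongly_stable:
  assumes "strongly_stable M q"
  obtains c :: real where "c \<ge> 0"
    "\<forall>\<^sub>F t in sequentially. (\<Sum>\<tau><t. \<integral>\<^sup>+\<omega>. of_nat (q \<tau> \<omega>) \<partial>M) \<le> ennreal (c * t)"
proof -
  let ?S = "\<lambda>t. \<Sum>\<tau><t. \<integral>\<^sup>+\<omega>. of_nat (q \<tau> \<omega>) \<partial>M"
  obtain y where y: "limsup (\<lambda>t. ?S t / of_nat t) < y" "y < \<infinity>"
    using dense assms unfolding strongly_stable_def by blast
  then obtain c where c: "y = ennreal c" "c \<ge> 0" by (cases y) auto
  have "\<forall>\<^sub>F t in sequentially. ?S t / of_nat t < ennreal c"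
    using y(1) c(1) by (auto dest: Limsup_lessD)
  then have "\<forall>\<^sub>F t in sequentially. ?S t \<le> ennreal (c * t)"
    using eventually_gt_at_top[of 0]
  proof eventually_elim
    case (elim t)
    have "?S t = ?S t / of_nat t * of_nat t"
      using elim(2) by (simp add: ennreal_divide_times ennreal_divide_self of_nat_less_top)
    also have "\<dots> \<le> ennreal c * of_nat t"
      using elim(1) by (intro mult_right_mono) auto
    also have "\<dots> = ennreal (c * t)"
      using c by (simp add: ennreal_mult ennreal_of_nat_eq_real_of_nat)
    finally show ?case .
  qed
  with c(2) that show ?thesis by blast
qed

text \<open>The upper half of the summands suffices.\<close>

lemma sum_sqrt_ge: "real n * sqrt n \<le> (\<Sum>\<tau><2 * n. sqrt (real \<tau>))"
proof -
  have "real n * sqrt n = (\<Sum>\<tau>\<in>{n..<2 * n}. sqrt (real n))" by simp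
  also have "\<dots> \<le> (\<Sum>\<tau>\<in>{n..<2 * n}. sqrt (real \<tau>))" by (intro sum_mono) auto
  also have "\<dots> \<le> (\<Sum>\<tau><2 * n. sqrt (real \<tau>))" by (intro sum_mono2) auto
  finally show ?thesis .
qed

theorem theorem1:
  fixes M :: "'w measure" and R :: "'u measure"
    and p lam :: "queue \<Rightarrow> real" and Amax :: real
    and A :: "queue \<Rightarrow> nat \<Rightarrow> 'w \<Rightarrow> nat"
    and C :: "queue \<Rightarrow> nat \<Rightarrow> 'w \<Rightarrow> bool"
    and seed :: "'w \<Rightarrow> 'u" and pol :: "'u policy"
    and m :: "nat \<Rightarrow> 'w \<Rightarrow> queue"
    and act :: "nat \<Rightarrow> 'w \<Rightarrow> bool"
    and D Q :: "queue \<Rightarrow> nat \<Rightarrow> 'w \<Rightarrow> nat"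
  assumes "\<And>i. 0 < p i \<and> p i < 1"
    and "two_queue_system M p lam Amax A C R seed pol m act D Q"
    and "\<And>i. strongly_stable M (Q i)"
  shows "lam Queue1 / p Queue1 + lam Queue2 / p Queue2 < 1"
proof (rule ccontr)
  assume overload: "\<not> lam Queue1 / p Queue1 + lam Queue2 / p Queue2 < 1"
  interpret nondegenerate_two_queue_system M p lam Amax A C R seed pol m act D Q
    using assms(1,2) by (simp add: nondegenerate_two_queue_system_def
        nondegenerate_two_queue_system_axioms_def)
  have \<rho>: "\<rho> \<ge> 1" using overload by (simp add: \<rho>_def)
  define E where "E i t = (\<integral>\<^sup>+\<omega>. of_nat (Q i t \<omega>) \<partial>M)" for i t
  obtain \<kappa> where \<kappa>: "\<kappa> > 0" "\<And>t. \<kappa> * sqrt t \<le> expectation (\<lambda>\<omega>. \<bar>walk t \<omega>\<bar>)"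
    using expectation_abs_walk_ge by blast
  obtain c1 :: real where c1: "c1 \<ge> 0" "\<forall>\<^sub>F t in sequentially. (\<Sum>\<tau><t. E Queue1 \<tau>) \<le> ennreal (c1 * t)"
    by (rule eventually_sum_le_of_strongly_stable[OF assms(3)[of Queue1], folded E_def])
  obtain c2 :: real where c2: "c2 \<ge> 0" "\<forall>\<^sub>F t in sequentially. (\<Sum>\<tau><t. E Queue2 \<tau>) \<le> ennreal (c2 * t)"
    by (rule eventually_sum_le_of_strongly_stable[OF assms(3)[of Queue2], folded E_def])
  define c where "c = \<beta> * (c1 + c2)"
  have "\<forall>\<^sub>F t in sequentially. \<kappa> / 4 * (\<Sum>\<tau><t. sqrt (real \<tau>)) \<le> c * t"
    using c1(2) c2(2)
  proof eventually_elim
    case (elim t)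
    have "ennreal (\<kappa> / 4 * (\<Sum>\<tau><t. sqrt (real \<tau>))) = (\<Sum>\<tau><t. ennreal (\<kappa> * sqrt \<tau> / 4))"
      using \<kappa>(1) by (subst sum_ennreal) (auto simp: sum_distrib_left)
    also have "\<dots> \<le> (\<Sum>\<tau><t. ennreal \<beta> * (E Queue1 \<tau> + E Queue2 \<tau>))"
      using \<kappa>(2) unfolding E_def
      by (intro sum_mono order_trans[OF ennreal_leI expected_backlog_ge[OF \<rho>]]) simp
    also have "\<dots> = ennreal \<beta> * ((\<Sum>\<tau><t. E Queue1 \<tau>) + (\<Sum>\<tau><t. E Queue2 \<tau>))"
      by (simp only: sum_distrib_left[symmetric] sum.distrib)
    also have "\<dots> \<le> ennreal \<beta> * (ennreal (c1 * t) + ennreal (c2 * t))"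
      using elim by (intro mult_left_mono add_mono) auto
    also have "\<dots> = ennreal (c * t)"
      using c1(1) c2(1) \<beta>_gt_1 by (simp add: c_def ennreal_mult[symmetric] ennreal_plus[symmetric]
          algebra_simps del: ennreal_plus)
    finally show ?case
      using c1(1) c2(1) \<beta>_gt_1 by (subst (asm) ennreal_le_iff) (auto simp: c_def)
  qed
  then obtain N where N: "\<And>t. t \<ge> N \<Longrightarrow> \<kappa> / 4 * (\<Sum>\<tau><t. sqrt (real \<tau>)) \<le> c * t"
    by (auto simp: eventually_sequentially)
  have bounded: "sqrt n \<le> 8 * c / \<kappa>" if n: "n \<ge> Suc N" for n
  proof -
    have "\<kappa> / 4 * (n * sqrt n) \<le> \<kappa> / 4 * (\<Sum>\<tau><2 * n. sqrt (real \<tau>))"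
      using \<kappa>(1) sum_sqrt_ge[of n] by (intro mult_left_mono) auto
    also have "\<dots> \<le> c * (2 * n)" using N[of "2 * n"] n by simp
    finally have "n * (\<kappa> / 4 * sqrt n) \<le> n * (2 * c)" by (simp add: algebra_simps)
    then have "\<kappa> / 4 * sqrt n \<le> 2 * c" using n by (simp add: mult_le_cancel_left)
    then show ?thesis using \<kappa>(1) by (simp add: field_simps)
  qed
  have "filterlim (\<lambda>n. sqrt (real n)) at_top sequentially"
    by (rule filterlim_compose[OF sqrt_at_top filterlim_real_sequentially])
  then have "\<forall>\<^sub>F n in sequentially. sqrt (real n) > 8 * c / \<kappa>"
    by (auto simp: filterlim_at_top_dense)
  then have "\<forall>\<^sub>F n::nat in sequentially. False"
    using eventually_ge_at_top[of "Suc N"] by eventually_elim (use bounded in force)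
  then show False by simp
qed

end
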